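(* (1) If $\alpha\in\big(\tfrac13,\tfrac{3-\sqrt5}{2}\big]$, then $D_\alpha=\big[0,\tfrac{\log 2}{-\log\alpha}\big]$. (2) If $\alpha\in\big(\tfrac{3-\sqrt5}{2},\tfrac12\big)$, then $D_\alpha$ is a proper subset of $\big[0,\tfrac{\log 2}{-\log\alpha}\big]$.
   Context: For $\alpha\in(0,1/2)$ let $\Gamma_{\alpha}:=\{\sum_{i=1}^{\infty}\epsilon_i\alpha^i:\epsilon_i\in\{0,1\},\ i\geq 1\}$, and for $t\in\mathbb{R}$ let $\Gamma_\alpha+t:=\{x+t:x\in\Gamma_\alpha\}$. Let $\Gamma_\alpha-\Gamma_\alpha=\{\sum_{i=1}^{\infty}\epsilon_i\alpha^i:\epsilon_i\in\{-1,0,1\},\ i\ge 1\}$ be the difference set. An $\alpha$-expansion of $t$ with alphabet $\{-1,0,1\}$ is a sequence $(t_i)_{i\ge1}\in\{-1,0,1\}^{\mathbb{N}}$ with $t=\sum_{i=1}^\infty t_i\alpha^i$. Let $\mathcal{U}_\alpha$ be the set of $t\in\Gamma_\alpha-\Gamma_\alpha$ having exactly one $\alpha$-expansion with alphabet $\{-1,0,1\}$, and let $$D_\alpha:=\{\dim_H(\Gamma_\alpha\cap(\Gamma_\alpha+t)):t\in\mathcal{U}_\alpha\},$$ where $\dim_H$ denotes Hausdorff dimension. *)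

theory Defs
  imports "HOL-Analysis.Analysis"
begin

text \<open>
  The term $|U|^s$ in the definition of the Hausdorff measure, with the usual conventions
  $|\emptyset|^s = 0$ for all $s \ge 0$ and $|U|^0 = 1$ for $U \neq \emptyset$.
  They have to be spelled out since \<open>0 powr 0 = 0\<close>.
\<close>

definition diam_power :: "real \<Rightarrow> 'a::metric_space set \<Rightarrow> ennreal" where
  "diam_power s U = (if U = {} then 0 else if s = 0 then 1 else ennreal (diameter U powr s))"

text \<open>
  Boundedness is required explicitly because \<^const>\<open>diameter\<close> is unspecified on unbounded sets.
  Finite covers are included, as \<open>U i = {}\<close> is allowed and contributes 0.
\<close>

definition hausdorff_premeasure :: "real \<Rightarrow> real \<Rightarrow> 'a::metric_space set \<Rightarrow> ennreal" where
  "hausdorff_premeasure s \<delta> E =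
     Inf {(\<Sum>i. diam_power s (U i)) | U :: nat \<Rightarrow> 'a set.
            E \<subseteq> (\<Union>i. U i) \<and> (\<forall>i. bounded (U i) \<and> diameter (U i) \<le> \<delta>)}"

definition hausdorff_measure :: "real \<Rightarrow> 'a::metric_space set \<Rightarrow> ennreal" where
  "hausdorff_measure s E = (SUP \<delta>\<in>{0<..}. hausdorff_premeasure s \<delta> E)"

text \<open>Extended-real valued, so that the infimum of the empty set is \<open>\<infinity>\<close>.\<close>

definition hausdorff_dim :: "'a::metric_space set \<Rightarrow> ereal" where
  "hausdorff_dim E = Inf {ereal s | s. 0 \<le> s \<and> hausdorff_measure s E = 0}"

text \<open>
  Digit sequences are indexed from 0: \<open>\<epsilon> i\<close> is the digit $\epsilon_{i+1}$, belonging to the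
  power $\alpha^{i+1}$.
\<close>

definition is_expansion :: "int set \<Rightarrow> real \<Rightarrow> (nat \<Rightarrow> int) \<Rightarrow> real \<Rightarrow> bool" where
  "is_expansion A \<alpha> \<epsilon> x \<longleftrightarrow>
     (\<forall>i. \<epsilon> i \<in> A) \<and> (\<lambda>i. of_int (\<epsilon> i) * \<alpha> ^ Suc i) sums x"

definition Gamma_set :: "real \<Rightarrow> real set" where
  "Gamma_set \<alpha> = {x. \<exists>\<epsilon>. is_expansion {0, 1} \<alpha> \<epsilon> x}"

definition Gamma_diff :: "real \<Rightarrow> real set" where
  "Gamma_diff \<alpha> = {x - y | x y. x \<in> Gamma_set \<alpha> \<and> y \<in> Gamma_set \<alpha>}"

lemma Gamma_diff_eq:
  assumes "0 < \<alpha>" "\<alpha> < 1/2"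
  shows "Gamma_diff \<alpha> = {t. \<exists>\<epsilon>. is_expansion {-1, 0, 1} \<alpha> \<epsilon> t}"
proof (intro equalityI subsetI)
  fix t assume "t \<in> Gamma_diff \<alpha>"
  then obtain a b x y where a: "is_expansion {0, 1} \<alpha> a x" and b: "is_expansion {0, 1} \<alpha> b y"
    and t: "t = x - y"
    by (auto simp: Gamma_diff_def Gamma_set_def)
  have "a i - b i \<in> {-1, 0, 1}" for i
  proof -
    have "a i \<in> {0, 1}" "b i \<in> {0, 1}" using a b by (auto simp: is_expansion_def)
    then show ?thesis by auto
  qed
  moreover have "(\<lambda>i. of_int (a i - b i) * \<alpha> ^ Suc i) sums t"
    using sums_diff[of "\<lambda>i. of_int (a i) * \<alpha> ^ Suc i" x "\<lambda>i. of_int (b i) * \<alpha> ^ Suc i" y] a b t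
    by (simp add: is_expansion_def left_diff_distrib)
  ultimately have "is_expansion {-1, 0, 1} \<alpha> (\<lambda>i. a i - b i) t"
    unfolding is_expansion_def by simp
  then show "t \<in> {t. \<exists>\<epsilon>. is_expansion {-1, 0, 1} \<alpha> \<epsilon> t}"
    by blast
next
  fix t assume "t \<in> {t. \<exists>\<epsilon>. is_expansion {-1, 0, 1} \<alpha> \<epsilon> t}"
  then obtain e where e: "\<And>i. e i \<in> {-1, 0, 1}" "(\<lambda>i. of_int (e i) * \<alpha> ^ Suc i) sums t"
    by (auto simp: is_expansion_def)
  define b where "b i = (if e i = -1 then 1 else 0 :: int)" for i
  have e_cases: "e i = -1 \<or> e i = 0 \<or> e i = 1" for i using e(1)[of i] by simp
  have "summable (\<lambda>i. \<alpha> ^ Suc i)"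
    using assms by (simp only: summable_Suc_iff) (rule summable_geometric, simp)
  then have "summable (\<lambda>i. of_int (b i) * \<alpha> ^ Suc i)"
    by (rule summable_comparison_test'[where N = 0]) (use assms in \<open>simp add: b_def\<close>)
  then obtain y where y: "(\<lambda>i. of_int (b i) * \<alpha> ^ Suc i) sums y"
    by (auto simp: summable_def)
  have "(\<lambda>i. of_int (e i + b i) * \<alpha> ^ Suc i) sums (t + y)"
    using sums_add[OF e(2) y] by (simp add: distrib_right)
  moreover have "e i + b i \<in> {0, 1}" "b i \<in> {0, 1}" for i
    using e_cases[of i] by (auto simp: b_def)
  ultimately have "is_expansion {0, 1} \<alpha> (\<lambda>i. e i + b i) (t + y)" "is_expansion {0, 1} \<alpha> b y"
    using y by (simp_all add: is_expansion_def)
  then have "t + y \<in> Gamma_set \<alpha>" "y \<in> Gamma_set \<alpha>"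
    unfolding Gamma_set_def by blast+
  then show "t \<in> Gamma_diff \<alpha>"
    unfolding Gamma_diff_def mem_Collect_eq by (metis add_diff_cancel_right')
qed

definition U_set :: "real \<Rightarrow> real set" where
  "U_set \<alpha> = {t \<in> Gamma_diff \<alpha>. \<exists>!\<epsilon>. is_expansion {-1, 0, 1} \<alpha> \<epsilon> t}"

definition D_set :: "real \<Rightarrow> ereal set" where
  "D_set \<alpha> = {hausdorff_dim (Gamma_set \<alpha> \<inter> (\<lambda>x. x + t) ` Gamma_set \<alpha>) | t. t \<in> U_set \<alpha>}"

end

theory Submission
  imports Defs
begin

text \<open>
  If $t$ has a unique expansion $(e_i)$ and $x \in \Gamma_\alpha \cap (\Gamma_\alpha + t)$ has
  digits $(\epsilon_i)$, then $(\epsilon_i - e_i)$ must be the digits of $x - t$, so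
  $\epsilon_i$ is forced to be 1 or 0 where $e_i = \pm 1$ and is free where $e_i = 0$. The
  intersection is therefore a Cantor set with a binary choice exactly at the zeros of $e$.
  If $e$ has $d n + O(1)$ zeros among its first $n$ digits, its dimension is
  $d \cdot \log 2 / (-\log \alpha)$. The upper bound (\<open>dim_digit_section_le\<close>) covers it by
  the $2^{dn + O(1)}$ cylinders of length $\alpha^n$. For the lower bound
  (\<open>dim_digit_section_ge\<close>) the free digits are filled with the binary digits of a number
  $u \in [0,1)$; this gives a map from $[0,1)$ into the set whose inverse is Hoelder
  continuous, so that a cheap cover would give a cover of $[0,1)$ by
  intervals of small total length.

  What remains is to see which zero patterns are compatible with uniqueness. Let
  $\gamma = (1 - 2\alpha)/(1 - \alpha)$ (\<open>gap\<close> below). Since the expansions with digits $-1, 0, 1$ fill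
  the interval $[-(1 - \gamma), 1 - \gamma]$ for $\alpha \ge 1/3$, a digit $e_n < 1$ could be
  raised by 1 iff the tail $\sum_{i \ge 1} e_{n+i} \alpha^i$ is at least $\gamma$, and symmetrically
  for $e_n > -1$. The number $(3 - \sqrt 5)/2$ is where $\gamma = \alpha$.

  If $\alpha \le \gamma$, then every sequence whose nonzero digits are infinitely many and
  alternate in sign is a unique expansion, because its tails are smaller than $\alpha$ in absolute
  value. The zeros of such a sequence can be placed freely, and every density $d < 1$
  is realised; $t = 0$ gives $d = 1$ (\<open>D_set_eq_interval\<close>).

  If $\gamma < \alpha$, then all tails after a zero of a unique expansion are smaller than $\gamma$ in absolute
  value, so a nonzero digit after it must be followed by a tail of absolute value greater than
  $1 - \gamma/\alpha > 0$, hence by another nonzero digit within a number $k$ of places that depends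
  only on $\alpha$. So from some point on the zeros occupy either all places or
  at most $k$ of any $k+1$ consecutive ones, and the dimensions strictly between
  $\frac{k}{k+1} \cdot \log 2 / (-\log \alpha)$ and $\log 2 / (-\log \alpha)$ do not occur
  (\<open>D_set_gap\<close>).
\<close>

section \<open>Bounds for the Hausdorff dimension\<close>

lemma hausdorff_dim_le:
  assumes "0 \<le> d" "\<And>s. d < s \<Longrightarrow> hausdorff_measure s E = 0"
  shows "hausdorff_dim E \<le> ereal d"
proof (rule ereal_le_epsilon2)
  fix \<epsilon> :: real assume "0 < \<epsilon>"
  then have "hausdorff_dim E \<le> ereal (d + \<epsilon>)"
    unfolding hausdorff_dim_def using assms by (intro Inf_lower) auto
  then show "hausdorff_dim E \<le> ereal d + ereal \<epsilon>"
    by simp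
qed

lemma hausdorff_dim_ge:
  assumes "\<And>s. 0 \<le> s \<Longrightarrow> s < d \<Longrightarrow> hausdorff_measure s E \<noteq> 0"
  shows "ereal d \<le> hausdorff_dim E"
  unfolding hausdorff_dim_def using assms by (intro Inf_greatest) (force simp: not_less[symmetric])

lemma hausdorff_dim_nonneg: "0 \<le> hausdorff_dim E"
  unfolding hausdorff_dim_def by (intro Inf_greatest) auto

lemma hausdorff_premeasure_le_finite_cover:
  fixes F :: "'a::metric_space set set"
  assumes F: "finite F" "E \<subseteq> \<Union>F" "\<And>A. A \<in> F \<Longrightarrow> bounded A \<and> diameter A \<le> r"
    and r: "0 < r" "r \<le> \<delta>" and s: "0 < s"
  shows "hausdorff_premeasure s \<delta> E \<le> ennreal (card F * r powr s)"
proof -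
  obtain h where h: "bij_betw h {0..<card F} F"
    using ex_bij_betw_nat_finite[OF F(1)] by blast
  define U where "U i = (if i < card F then h i else {})" for i
  have hF: "h i \<in> F" if "i < card F" for i
    using h that by (auto simp: bij_betw_def)
  have U: "bounded (U i) \<and> diameter (U i) \<le> r" for i
    using F(3) hF r(1) by (auto simp: U_def)
  have "E \<subseteq> (\<Union>i. U i)"
  proof
    fix x assume "x \<in> E"
    then obtain A where "A \<in> F" "x \<in> A" using F(2) by blast
    moreover from \<open>A \<in> F\<close> have "A \<in> h ` {0..<card F}"
      using h by (simp add: bij_betw_def)
    ultimately obtain i where "i < card F" "h i = A"
      by auto
    then show "x \<in> (\<Union>i. U i)"
      using \<open>x \<in> A\<close> by (auto simp: U_def)
  qed
  then have "hausdorff_premeasure s \<delta> E \<le> (\<Sum>i. diam_power s (U i))"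
    unfolding hausdorff_premeasure_def using U r(2)
    by (intro Inf_lower) (auto intro: order_trans)
  also have "\<dots> = (\<Sum>i<card F. diam_power s (U i))"
    by (rule suminf_finite) (auto simp: U_def diam_power_def)
  also have "\<dots> \<le> (\<Sum>i<card F. ennreal (r powr s))"
  proof (rule sum_mono)
    fix i
    have "diameter (U i) powr s \<le> r powr s"
      using U[of i] s by (intro powr_mono2) (auto simp: diameter_ge_0)
    then show "diam_power s (U i) \<le> ennreal (r powr s)"
      using s by (simp add: diam_power_def ennreal_leI)
  qed
  also have "\<dots> = ennreal (card F * r powr s)"
    by (simp add: ennreal_mult ennreal_of_nat_eq_real_of_nat)
  finally show ?thesis .
qed

text \<open>
  This replaces the mass distribution principle: the preimages under \<open>g\<close> of the members of a
  cover of \<open>E\<close> cover $[0,1)$, and by the inverse Hoelder condition each lies in an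
  interval of length at most \<open>2 * C\<close> times the contribution of that member, so Lebesgue measure
  bounds the sum of the contributions from below.
\<close>

lemma hausdorff_measure_nonzero_if_inverse_hoelder:
  fixes g :: "real \<Rightarrow> 'a::metric_space"
  assumes s: "0 \<le> s" and C: "0 < C" and g: "g ` {0..<1} \<subseteq> E"
    and hoelder: "\<And>u v. u \<in> {0..<1} \<Longrightarrow> v \<in> {0..<1} \<Longrightarrow> \<bar>u - v\<bar> \<le> C * dist (g u) (g v) powr s"
  shows "hausdorff_measure s E \<noteq> 0"
proof -
  have sum_ge: "ennreal (1 / (2 * C)) \<le> (\<Sum>i. diam_power s (U i))"
    if cover: "E \<subseteq> (\<Union>i. U i)" and bdd: "\<And>i. bounded (U i)" for U :: "nat \<Rightarrow> 'a set"
  proof -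
    have "\<exists>J. {u \<in> {0..<1}. g u \<in> U i} \<subseteq> J \<and> J \<in> sets lborel
            \<and> emeasure lborel J \<le> ennreal (2 * C) * diam_power s (U i)" for i
    proof (cases "{u \<in> {0..<1}. g u \<in> U i} = {}")
      case True
      then show ?thesis by (intro exI[of _ "{}"]) simp
    next
      case False
      then obtain u where u: "u \<in> {0..<1}" "g u \<in> U i" by blast
      \<comment> \<open>The case distinction mirrors the convention $|U|^0 = 1$, which singletons do not satisfy for \<open>powr\<close>.\<close>
      define L where "L = C * (if s = 0 then 1 else diameter (U i) powr s)"
      have "0 \<le> L"
        using C by (simp add: L_def)
      have L: "\<bar>u - v\<bar> \<le> L" if v: "v \<in> {0..<1}" "g v \<in> U i" for v
      proof -
        have "dist (g u) (g v) powr s \<le> (if s = 0 then 1 else diameter (U i) powr s)"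
          using s diameter_bounded_bound[OF bdd u(2) v(2)] by (auto intro: powr_mono2)
        then show ?thesis
          using hoelder[OF u(1) v(1)] C unfolding L_def
          by (meson mult_left_mono less_imp_le order_trans)
      qed
      have "{u \<in> {0..<1}. g u \<in> U i} \<subseteq> {u - L..u + L}"
        using L by (force simp: abs_le_iff)
      moreover have "emeasure lborel {u - L..u + L} = ennreal (2 * C) * diam_power s (U i)"
      proof -
        have "emeasure lborel {u - L..u + L} = ennreal (2 * L)"
          using \<open>0 \<le> L\<close> by simp
        also have "\<dots> = ennreal (2 * C) * diam_power s (U i)"
          using u(2) C by (auto simp: L_def diam_power_def ennreal_mult[symmetric] mult.assoc)
        finally show ?thesis .
      qed
      ultimately show ?thesis
        by (intro exI[of _ "{u - L..u + L}"]) simp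
    qed
    then obtain J where J: "\<And>i. {u \<in> {0..<1}. g u \<in> U i} \<subseteq> J i" "\<And>i. J i \<in> sets lborel"
      "\<And>i. emeasure lborel (J i) \<le> ennreal (2 * C) * diam_power s (U i)"
      by metis
    have "{0..<1} \<subseteq> (\<Union>i. J i)"
    proof
      fix u :: real assume u: "u \<in> {0..<1}"
      then obtain i where "g u \<in> U i"
        using g cover by blast
      then show "u \<in> (\<Union>i. J i)"
        using J(1)[of i] u by blast
    qed
    then have "emeasure lborel {0..<1::real} \<le> emeasure lborel (\<Union>i. J i)"
      using J(2) by (intro emeasure_mono) auto
    also have "\<dots> \<le> (\<Sum>i. emeasure lborel (J i))"
      using J(2) by (intro emeasure_subadditive_countably) auto
    also have "\<dots> \<le> (\<Sum>i. ennreal (2 * C) * diam_power s (U i))"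
      using J(3) by (intro suminf_le) auto
    also have "\<dots> = ennreal (2 * C) * (\<Sum>i. diam_power s (U i))"
      by simp
    finally have "1 \<le> ennreal (2 * C) * (\<Sum>i. diam_power s (U i))"
      by simp
    then have "ennreal (1 / (2 * C)) * 1 \<le> ennreal (1 / (2 * C)) * (ennreal (2 * C) * (\<Sum>i. diam_power s (U i)))"
      by (rule mult_left_mono) simp
    also have "\<dots> = (\<Sum>i. diam_power s (U i))"
      using C by (simp add: mult.assoc[symmetric] ennreal_mult[symmetric])
    finally show ?thesis by simp
  qed
  have "ennreal (1 / (2 * C)) \<le> hausdorff_premeasure s 1 E"
    unfolding hausdorff_premeasure_def by (intro Inf_greatest) (use sum_ge in blast)
  also have "\<dots> \<le> hausdorff_measure s E"
    unfolding hausdorff_measure_def by (intro SUP_upper) simp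
  finally show ?thesis
    using C by (auto simp: ennreal_eq_0_iff)
qed

section \<open>Digit sums and their tails\<close>

definition digit_sum :: "real \<Rightarrow> (nat \<Rightarrow> int) \<Rightarrow> real" where
  "digit_sum \<alpha> e = (\<Sum>i. of_int (e i) * \<alpha> ^ Suc i)"

text \<open>
  Since digits are indexed from 0, the tail from \<open>n\<close> on starts with the digit at \<open>n\<close>, weighted
  by \<open>\<alpha>\<close>; the tail after a digit \<open>n\<close> is the one with index \<open>Suc n\<close>.
\<close>

definition tail :: "real \<Rightarrow> (nat \<Rightarrow> int) \<Rightarrow> nat \<Rightarrow> real" where
  "tail \<alpha> e n = digit_sum \<alpha> (\<lambda>i. e (i + n))"

definition zeros :: "(nat \<Rightarrow> int) \<Rightarrow> nat \<Rightarrow> nat" where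
  "zeros e n = card {i. i < n \<and> e i = 0}"

text \<open>
  The digit sequences of the points of $\Gamma_\alpha \cap (\Gamma_\alpha + t)$, for a
  $t$ with the unique expansion \<open>e\<close>.
\<close>

definition admissible :: "(nat \<Rightarrow> int) \<Rightarrow> (nat \<Rightarrow> int) \<Rightarrow> bool" where
  "admissible e \<epsilon> \<longleftrightarrow> (\<forall>i. \<epsilon> i \<in> {0, 1} \<and> \<epsilon> i - e i \<in> {0, 1})"

definition unique_digits :: "real \<Rightarrow> (nat \<Rightarrow> int) \<Rightarrow> bool" where
  "unique_digits \<alpha> e \<longleftrightarrow> (\<forall>i. e i \<in> {-1, 0, 1}) \<and>
     (\<forall>s. (\<forall>i. s i \<in> {-1, 0, 1}) \<longrightarrow> digit_sum \<alpha> s = digit_sum \<alpha> e \<longrightarrow> s = e)"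

lemma digit_abs_le: "d \<in> {-1, 0, 1} \<longleftrightarrow> \<bar>d\<bar> \<le> 1" for d :: int
  by auto

lemma zeros_0 [simp]: "zeros e 0 = 0"
  by (simp add: zeros_def)

lemma zeros_Suc: "zeros e (Suc n) = zeros e n + (if e n = 0 then 1 else 0)"
proof -
  have "{i. i < Suc n \<and> e i = 0} = {i. i < n \<and> e i = 0} \<union> (if e n = 0 then {n} else {})"
    by (auto simp: less_Suc_eq)
  then show ?thesis
    by (auto simp: zeros_def)
qed

lemma zeros_le: "zeros e n \<le> n"
  by (induction n) (auto simp: zeros_Suc)

locale contraction =
  fixes \<alpha> :: real
  assumes pos: "0 < \<alpha>" and less_half: "\<alpha> < 1/2"
begin

text \<open>
  The sums with digits of absolute value at most 1 have absolute value at most \<open>radius\<close>;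
  \<open>gap\<close> is the least absolute value of \<open>d + r\<close> for a nonzero integer \<open>d\<close> and
  \<open>\<bar>r\<bar> \<le> radius\<close>.
\<close>

definition "radius = \<alpha> / (1 - \<alpha>)"
definition "gap = (1 - 2 * \<alpha>) / (1 - \<alpha>)"
definition "full_dim = ln 2 / (- ln \<alpha>)"

lemma radius_gap: "radius = 1 - gap"
  using less_half by (simp add: radius_def gap_def field_simps)

lemma radius_pos: "0 < radius" and gap_pos: "0 < gap" and radius_le_1: "radius \<le> 1"
  using pos less_half by (auto simp: radius_def gap_def field_simps)

lemma ln_neg: "ln \<alpha> < 0"
  using pos less_half by simp

lemma full_dim_pos: "0 < full_dim"
  using ln_neg by (simp add: full_dim_def divide_pos_neg)

lemma ratio_powr_full_dim: "\<alpha> powr full_dim = 1 / 2"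
proof -
  have "\<alpha> powr full_dim = exp (- ln 2)"
    using pos ln_neg by (simp add: powr_def full_dim_def)
  then show ?thesis
    by (simp add: exp_minus)
qed

lemma sums_geometric_radius: "(\<lambda>i. \<alpha> ^ Suc i) sums radius"
  using sums_mult[OF geometric_sums[of \<alpha>], of \<alpha>] pos less_half by (simp add: radius_def)

lemma summable_digits:
  assumes "\<And>i. \<bar>e i\<bar> \<le> 1"
  shows "summable (\<lambda>i. of_int (e i) * \<alpha> ^ Suc i)"
proof (rule summable_comparison_test'[where N = 0])
  show "summable (\<lambda>i. \<alpha> ^ Suc i)"
    using sums_geometric_radius by (rule sums_summable)
  fix n
  have "\<bar>real_of_int (e n)\<bar> \<le> 1"
    using assms[of n] by linarith
  then show "norm (of_int (e n) * \<alpha> ^ Suc n) \<le> \<alpha> ^ Suc n"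
    using pos by (simp add: abs_mult mult_left_le_one_le)
qed

lemma expansion_iff:
  assumes "\<And>d. d \<in> A \<Longrightarrow> \<bar>d\<bar> \<le> 1"
  shows "is_expansion A \<alpha> e x \<longleftrightarrow> (\<forall>i. e i \<in> A) \<and> digit_sum \<alpha> e = x"
proof -
  have "summable (\<lambda>i. of_int (e i) * \<alpha> ^ Suc i)" if "\<forall>i. e i \<in> A"
    using that assms by (intro summable_digits) auto
  then show ?thesis
    unfolding is_expansion_def digit_sum_def by (auto simp: sums_iff simp del: power_Suc)
qed

lemma digit_sum_diff:
  assumes "\<And>i. \<bar>e i\<bar> \<le> 1" "\<And>i. \<bar>s i\<bar> \<le> 1"
  shows "digit_sum \<alpha> e - digit_sum \<alpha> s = digit_sum \<alpha> (\<lambda>i. e i - s i)"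
  using suminf_diff[OF summable_digits[OF assms(1)] summable_digits[OF assms(2)]]
  by (simp add: digit_sum_def left_diff_distrib)

lemma tail_uminus:
  assumes "\<And>i. \<bar>e i\<bar> \<le> 1"
  shows "tail \<alpha> (\<lambda>i. - e i) n = - tail \<alpha> e n"
  using suminf_minus[OF summable_digits[of "\<lambda>i. e (i + n)"]] assms
  by (simp add: digit_sum_def tail_def)

lemma digit_sum_bounds:
  assumes "\<And>i. \<bar>e i\<bar> \<le> 1"
  shows "\<bar>digit_sum \<alpha> e\<bar> \<le> radius"
proof -
  have "norm (digit_sum \<alpha> e) \<le> (\<Sum>i. \<alpha> ^ Suc i)"
    unfolding digit_sum_def
  proof (rule norm_suminf_le)
    show "summable (\<lambda>i. \<alpha> ^ Suc i)"
      using sums_geometric_radius by (rule sums_summable)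
    fix n
    have "\<bar>real_of_int (e n)\<bar> \<le> 1"
      using assms[of n] by linarith
    then show "norm (of_int (e n) * \<alpha> ^ Suc n) \<le> \<alpha> ^ Suc n"
      using pos by (simp add: abs_mult mult_left_le_one_le)
  qed
  then show ?thesis
    using sums_geometric_radius by (simp add: sums_iff)
qed

lemma tail_bounds: "\<bar>tail \<alpha> e n\<bar> \<le> radius" if "\<And>i. \<bar>e i\<bar> \<le> 1"
  unfolding tail_def by (rule digit_sum_bounds) (rule that)

lemma digit_sum_split:
  assumes "\<And>i. \<bar>e i\<bar> \<le> 1"
  shows "digit_sum \<alpha> e = (\<Sum>i<n. of_int (e i) * \<alpha> ^ Suc i) + \<alpha> ^ n * tail \<alpha> e n"
proof -
  have "(\<Sum>i. of_int (e (i + n)) * \<alpha> ^ Suc (i + n)) = \<alpha> ^ n * tail \<alpha> e n"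
    unfolding tail_def digit_sum_def
    using suminf_mult[OF summable_digits[of "\<lambda>i. e (i + n)"], of "\<alpha> ^ n"] assms
    by (simp add: power_add mult_ac)
  then show ?thesis
    using suminf_split_initial_segment[OF summable_digits[of e], of n] assms
    by (simp add: digit_sum_def)
qed

lemma tail_step:
  assumes "\<And>i. \<bar>e i\<bar> \<le> 1"
  shows "tail \<alpha> e n = \<alpha> * (of_int (e n) + tail \<alpha> e (Suc n))"
  using digit_sum_split[of "\<lambda>i. e (i + n)" 1] assms
  by (simp add: tail_def algebra_simps)

text \<open>
  Separation of the cylinders: the first nonzero digit contributes $\alpha^{n+1}$ and the rest
  cannot cancel more than the fraction \<open>radius\<close> of it.
\<close>

lemma digit_sum_first_difference:
  assumes "\<And>i. \<bar>e i\<bar> \<le> 1" "\<And>i. i < n \<Longrightarrow> e i = 0" "e n \<noteq> 0"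
  shows "gap * \<alpha> ^ Suc n \<le> \<bar>digit_sum \<alpha> e\<bar>"
proof -
  have "digit_sum \<alpha> e = \<alpha> ^ n * tail \<alpha> e n"
    using digit_sum_split[of e n] assms by simp
  also have "\<dots> = \<alpha> ^ Suc n * (of_int (e n) + tail \<alpha> e (Suc n))"
    using tail_step[of e n] assms by simp
  finally have eq: "digit_sum \<alpha> e = \<alpha> ^ Suc n * (of_int (e n) + tail \<alpha> e (Suc n))" .
  have "1 \<le> \<bar>real_of_int (e n)\<bar>"
    using assms(3) by linarith
  moreover have "\<bar>tail \<alpha> e (Suc n)\<bar> \<le> 1 - gap"
    using tail_bounds[of e "Suc n"] assms(1) unfolding radius_gap by simp
  ultimately have "gap \<le> \<bar>of_int (e n) + tail \<alpha> e (Suc n)\<bar>"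
    by linarith
  then show ?thesis
    using mult_right_mono[of gap _ "\<alpha> ^ Suc n"] pos by (simp add: eq abs_mult mult.commute)
qed

section \<open>Unique expansions\<close>

lemma U_set_eq: "U_set \<alpha> = digit_sum \<alpha> ` {e. unique_digits \<alpha> e}"
proof (rule set_eqI)
  fix t
  have exp: "is_expansion {-1, 0, 1} \<alpha> e t \<longleftrightarrow> (\<forall>i. e i \<in> {-1, 0, 1}) \<and> digit_sum \<alpha> e = t" for e
    by (rule expansion_iff) auto
  have unique: "(\<exists>!e. D e \<and> f e = t) \<longleftrightarrow> (\<exists>e. (D e \<and> (\<forall>s. D s \<longrightarrow> f s = f e \<longrightarrow> s = e)) \<and> f e = t)"
    for D :: "(nat \<Rightarrow> int) \<Rightarrow> bool" and f
    by (auto simp: Ex1_def)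
  have "t \<in> U_set \<alpha> \<longleftrightarrow> (\<exists>!e. is_expansion {-1, 0, 1} \<alpha> e t)"
    unfolding U_set_def mem_Collect_eq Gamma_diff_eq[OF pos less_half]
    by (rule iffI, erule conjunct2, rule conjI, erule ex1_implies_ex, assumption)
  also have "\<dots> \<longleftrightarrow> (\<exists>e. unique_digits \<alpha> e \<and> digit_sum \<alpha> e = t)"
    unfolding exp unique unique_digits_def ..
  finally show "t \<in> U_set \<alpha> \<longleftrightarrow> t \<in> digit_sum \<alpha> ` {e. unique_digits \<alpha> e}"
    by (auto simp: image_iff)
qed

text \<open>
  At the first difference of two expansions of the same number the digits differ by at least 1, so
  the tails do too; but one of them is smaller than \<open>gap\<close> and the other at most
  \<open>radius = 1 - gap\<close>.
\<close>

lemma unique_digits_if_small_tails: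
  assumes dig: "\<And>i. \<bar>e i\<bar> \<le> 1" and small: "\<And>n. \<bar>tail \<alpha> e n\<bar> < gap"
  shows "unique_digits \<alpha> e"
  unfolding unique_digits_def digit_abs_le
proof (intro conjI allI impI)
  fix s assume s: "\<forall>i. \<bar>s i\<bar> \<le> 1" and eq: "digit_sum \<alpha> s = digit_sum \<alpha> e"
  show "s = e"
  proof (rule ccontr)
    assume "s \<noteq> e"
    then have ex: "\<exists>n. s n \<noteq> e n" by auto
    define n where "n = (LEAST n. s n \<noteq> e n)"
    have n: "s n \<noteq> e n" "\<And>i. i < n \<Longrightarrow> s i = e i"
      using LeastI_ex[OF ex] not_less_Least unfolding n_def by blast+
    have "(\<Sum>i<n. of_int (s i) * \<alpha> ^ Suc i) = (\<Sum>i<n. of_int (e i) * \<alpha> ^ Suc i)"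
      using n(2) by simp
    moreover have "digit_sum \<alpha> s = (\<Sum>i<n. of_int (s i) * \<alpha> ^ Suc i) + \<alpha> ^ n * tail \<alpha> s n"
      using s by (intro digit_sum_split) simp
    moreover have "digit_sum \<alpha> e = (\<Sum>i<n. of_int (e i) * \<alpha> ^ Suc i) + \<alpha> ^ n * tail \<alpha> e n"
      using dig by (rule digit_sum_split)
    ultimately have "\<alpha> ^ n * tail \<alpha> s n = \<alpha> ^ n * tail \<alpha> e n"
      using eq by linarith
    then have "tail \<alpha> s n = tail \<alpha> e n"
      using pos by simp
    then have "\<alpha> * (of_int (s n) + tail \<alpha> s (Suc n)) = \<alpha> * (of_int (e n) + tail \<alpha> e (Suc n))"
      using tail_step[of s n] tail_step[of e n] s dig by simp
    then have "of_int (s n) + tail \<alpha> s (Suc n) = of_int (e n) + tail \<alpha> e (Suc n)"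
      using pos by simp
    moreover have "1 \<le> \<bar>real_of_int (s n) - of_int (e n)\<bar>"
      using n(1) by linarith
    moreover have "\<bar>tail \<alpha> s (Suc n)\<bar> \<le> 1 - gap"
      using tail_bounds[of s "Suc n"] s unfolding radius_gap by simp
    ultimately show False
      using small[of "Suc n"] by linarith
  qed
qed (use dig in auto)

text \<open>
  A greedy algorithm: rounding \<open>x / \<alpha>\<close> to the nearest digit leaves a remainder in
  \<open>[-radius, radius]\<close> again, because \<open>radius / \<alpha> = 1 + radius\<close> and because
  \<open>radius\<close> is at least \<open>1/2\<close> when \<open>\<alpha> \<ge> 1/3\<close>.
\<close>

lemma digit_sum_surj:
  assumes third: "1/3 \<le> \<alpha>" and x: "\<bar>x\<bar> \<le> radius"
  shows "\<exists>s. (\<forall>i. \<bar>s i\<bar> \<le> 1) \<and> digit_sum \<alpha> s = x"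
proof -
  define digit :: "real \<Rightarrow> int" where
    "digit y = (if y > 1/2 then 1 else if y < -1/2 then -1 else 0)" for y
  define r where "r = rec_nat x (\<lambda>_ y. y / \<alpha> - of_int (digit (y / \<alpha>)))"
  define s where "s i = digit (r i / \<alpha>)" for i
  have r_Suc: "r (Suc i) = r i / \<alpha> - of_int (s i)" and r_0: "r 0 = x" for i
    by (simp_all add: r_def s_def)
  have s: "\<bar>s i\<bar> \<le> 1" for i
    by (simp add: s_def digit_def)
  have half: "1/2 \<le> radius"
    using third less_half by (simp add: radius_def field_simps)
  have step: "\<bar>y - of_int (digit y)\<bar> \<le> radius" if "\<bar>y\<bar> \<le> 1 + radius" for y
  proof -
    consider "y > 1/2" | "y < -1/2" | "-1/2 \<le> y" "y \<le> 1/2" by linarith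
    then show ?thesis
      by cases (use half that in \<open>simp_all add: digit_def abs_le_iff\<close>)
  qed
  have r: "\<bar>r i\<bar> \<le> radius" for i
  proof (induction i)
    case 0
    then show ?case using x r_0 by simp
  next
    case (Suc i)
    have "\<bar>r i / \<alpha>\<bar> \<le> radius / \<alpha>"
      using divide_right_mono[OF Suc, of \<alpha>] pos by simp
    also have "\<dots> = 1 + radius"
      using pos less_half by (simp add: radius_def field_simps)
    finally have "\<bar>r i / \<alpha>\<bar> \<le> 1 + radius" .
    then show ?case
      using step[of "r i / \<alpha>"] by (simp add: r_Suc s_def)
  qed
  have partial: "x = (\<Sum>i<n. of_int (s i) * \<alpha> ^ Suc i) + \<alpha> ^ n * r n" for n
    by (induction n) (use pos in \<open>auto simp: r_0 r_Suc field_simps\<close>)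
  have "(\<lambda>n. \<alpha> ^ n * r n) \<longlonglongrightarrow> 0"
  proof (rule Lim_null_comparison)
    show "\<forall>\<^sub>F n in sequentially. norm (\<alpha> ^ n * r n) \<le> \<alpha> ^ n * radius"
      using r pos by (intro always_eventually allI) (simp add: abs_mult mult_left_mono)
    show "(\<lambda>n. \<alpha> ^ n * radius) \<longlonglongrightarrow> 0"
      using pos less_half by (intro tendsto_mult_left_zero LIMSEQ_power_zero) auto
  qed
  then have "(\<lambda>n. x - \<alpha> ^ n * r n) \<longlonglongrightarrow> x - 0"
    by (intro tendsto_intros)
  moreover have "x - \<alpha> ^ n * r n = (\<Sum>i<n. of_int (s i) * \<alpha> ^ Suc i)" for n
    using partial[of n] by simp
  ultimately have "(\<lambda>i. of_int (s i) * \<alpha> ^ Suc i) sums x"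
    by (simp add: sums_def)
  then show ?thesis
    using s by (auto simp: digit_sum_def sums_iff)
qed

lemma unique_digits_abs: "unique_digits \<alpha> e \<Longrightarrow> \<bar>e i\<bar> \<le> 1"
  unfolding unique_digits_def digit_abs_le by blast

lemma unique_digits_uminus:
  assumes "unique_digits \<alpha> e"
  shows "unique_digits \<alpha> (\<lambda>i. - e i)"
  unfolding unique_digits_def digit_abs_le
proof (intro conjI allI impI)
  note dig = unique_digits_abs[OF assms]
  fix s assume s: "\<forall>i. \<bar>s i\<bar> \<le> 1" and eq: "digit_sum \<alpha> s = digit_sum \<alpha> (\<lambda>i. - e i)"
  have "digit_sum \<alpha> (\<lambda>i. - s i) = digit_sum \<alpha> e"
    using eq tail_uminus[of s 0] tail_uminus[of e 0] s dig by (simp add: tail_def)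
  then have "(\<lambda>i. - s i) = e"
    using assms s unfolding unique_digits_def digit_abs_le by auto
  then show "s = (\<lambda>i. - e i)"
    by auto
qed (use unique_digits_abs[OF assms] in auto)

text \<open>
  Otherwise the digit \<open>e n\<close> can be raised by 1: the tail needed to compensate for it lies in
  \<open>[-radius, radius]\<close> and hence has an expansion.
\<close>

lemma unique_tail_less_gap:
  assumes third: "1/3 \<le> \<alpha>" and u: "unique_digits \<alpha> e" and n: "e n < 1"
  shows "tail \<alpha> e (Suc n) < gap"
proof (rule ccontr)
  note dig = unique_digits_abs[OF u]
  assume "\<not> tail \<alpha> e (Suc n) < gap"
  then have "\<bar>tail \<alpha> e (Suc n) - 1\<bar> \<le> radius"
    using tail_bounds[of e "Suc n"] dig radius_gap radius_le_1 by (auto simp: abs_le_iff)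
  then obtain s' where s': "\<And>i. \<bar>s' i\<bar> \<le> 1" "digit_sum \<alpha> s' = tail \<alpha> e (Suc n) - 1"
    using digit_sum_surj[OF third] by blast
  define s where "s i = (if i < n then e i else if i = n then e n + 1 else s' (i - Suc n))" for i
  have s: "\<bar>s i\<bar> \<le> 1" for i
    using dig[of i] s'(1) dig[of n] n by (auto simp: s_def)
  have "tail \<alpha> s (Suc n) = tail \<alpha> e (Suc n) - 1"
    unfolding s'(2)[symmetric] by (simp add: tail_def s_def)
  then have "tail \<alpha> s n = tail \<alpha> e n"
    using tail_step[of s n] tail_step[of e n] s dig by (simp add: s_def)
  then have "digit_sum \<alpha> s = digit_sum \<alpha> e"
    using digit_sum_split[of s n] digit_sum_split[of e n] s dig by (simp add: s_def)
  then have "s = e"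
    using u s unfolding unique_digits_def digit_abs_le by auto
  then have "s n = e n" by simp
  then show False
    by (simp add: s_def)
qed

lemma unique_tail_greater_gap:
  assumes third: "1/3 \<le> \<alpha>" and u: "unique_digits \<alpha> e" and n: "-1 < e n"
  shows "- gap < tail \<alpha> e (Suc n)"
  using unique_tail_less_gap[OF third unique_digits_uminus[OF u], of n] n
    tail_uminus[of e "Suc n"] unique_digits_abs[OF u] by simp

section \<open>Sections\<close>

lemma Gamma_set_eq: "Gamma_set \<alpha> = digit_sum \<alpha> ` {\<epsilon>. \<forall>i. \<epsilon> i \<in> {0, 1}}"
proof -
  have "is_expansion {0, 1} \<alpha> \<epsilon> x \<longleftrightarrow> (\<forall>i. \<epsilon> i \<in> {0, 1}) \<and> digit_sum \<alpha> \<epsilon> = x" for \<epsilon> x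
    by (rule expansion_iff) auto
  then show ?thesis
    unfolding Gamma_set_def by (auto simp: image_iff)
qed

lemma intersection_eq:
  assumes "unique_digits \<alpha> e"
  shows "Gamma_set \<alpha> \<inter> (\<lambda>x. x + digit_sum \<alpha> e) ` Gamma_set \<alpha> = digit_sum \<alpha> ` {\<epsilon>. admissible e \<epsilon>}"
proof (intro equalityI subsetI)
  have abs: "\<bar>\<epsilon> i\<bar> \<le> 1" if "\<forall>i. \<epsilon> i \<in> {0, 1 :: int}" for \<epsilon> and i :: nat
    using that[rule_format, of i] by auto
  note e = unique_digits_abs[OF assms]
  {
    fix x assume "x \<in> Gamma_set \<alpha> \<inter> (\<lambda>x. x + digit_sum \<alpha> e) ` Gamma_set \<alpha>"
    then obtain a b where a: "\<forall>i. a i \<in> {0, 1}" "x = digit_sum \<alpha> a"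
      and b: "\<forall>i. b i \<in> {0, 1}" "x = digit_sum \<alpha> b + digit_sum \<alpha> e"
      unfolding Gamma_set_eq by blast
    have "digit_sum \<alpha> a - digit_sum \<alpha> b = digit_sum \<alpha> (\<lambda>i. a i - b i)"
      using abs[OF a(1)] abs[OF b(1)] by (rule digit_sum_diff)
    then have "digit_sum \<alpha> (\<lambda>i. a i - b i) = digit_sum \<alpha> e"
      using a(2) b(2) by linarith
    moreover have "a i - b i \<in> {-1, 0, 1}" for i
      using a(1)[rule_format, of i] b(1)[rule_format, of i] by auto
    ultimately have "(\<lambda>i. a i - b i) = e"
      using assms[unfolded unique_digits_def, THEN conjunct2, rule_format, of "\<lambda>i. a i - b i"] by simp
    then have "a i - e i = b i" for i
      by auto
    then have "admissible e a"
      using a(1) b(1) by (simp add: admissible_def)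
    then show "x \<in> digit_sum \<alpha> ` {\<epsilon>. admissible e \<epsilon>}"
      using a(2) by blast
  next
    fix x assume "x \<in> digit_sum \<alpha> ` {\<epsilon>. admissible e \<epsilon>}"
    then obtain a where a: "\<forall>i. a i \<in> {0, 1}" "\<forall>i. a i - e i \<in> {0, 1}" "x = digit_sum \<alpha> a"
      unfolding admissible_def by blast
    have "digit_sum \<alpha> a - digit_sum \<alpha> e = digit_sum \<alpha> (\<lambda>i. a i - e i)"
      using abs[OF a(1)] e by (rule digit_sum_diff)
    then have "x = digit_sum \<alpha> (\<lambda>i. a i - e i) + digit_sum \<alpha> e"
      using a(3) by linarith
    moreover have "x \<in> Gamma_set \<alpha>"
      unfolding Gamma_set_eq a(3) by (intro imageI CollectI) (rule a(1))
    moreover have "digit_sum \<alpha> (\<lambda>i. a i - e i) \<in> Gamma_set \<alpha>"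
      unfolding Gamma_set_eq by (intro imageI CollectI) (rule a(2))
    ultimately show "x \<in> Gamma_set \<alpha> \<inter> (\<lambda>x. x + digit_sum \<alpha> e) ` Gamma_set \<alpha>"
      by blast
  }
qed

section \<open>Dimension of the digit sections\<close>

abbreviation "digit_section e \<equiv> digit_sum \<alpha> ` {\<epsilon>. admissible e \<epsilon>}"

lemma D_set_eq: "D_set \<alpha> = (\<lambda>e. hausdorff_dim (digit_section e)) ` {e. unique_digits \<alpha> e}"
proof -
  have "D_set \<alpha> = (\<lambda>t. hausdorff_dim (Gamma_set \<alpha> \<inter> (\<lambda>x. x + t) ` Gamma_set \<alpha>)) ` U_set \<alpha>"
    unfolding D_set_def by auto
  also have "\<dots> = (\<lambda>e. hausdorff_dim (digit_section e)) ` {e. unique_digits \<alpha> e}"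
    unfolding U_set_eq image_image by (rule image_cong) (simp_all add: intersection_eq)
  finally show ?thesis .
qed

lemma admissible_abs: "admissible e \<epsilon> \<Longrightarrow> \<bar>\<epsilon> i\<bar> \<le> 1"
  by (auto simp: admissible_def dest: spec[of _ i])

lemma admissible_forced:
  assumes "admissible e \<epsilon>" "\<bar>e n\<bar> \<le> 1" "e n \<noteq> 0"
  shows "\<epsilon> n = (if e n = 1 then 1 else 0)"
proof -
  have "\<epsilon> n \<in> {0, 1}" "\<epsilon> n - e n \<in> {0, 1}"
    using assms(1) by (simp_all add: admissible_def)
  then show ?thesis
    using assms(2,3) by auto
qed

abbreviation "prefix_sum n \<epsilon> \<equiv> (\<Sum>i<n. real_of_int (\<epsilon> i) * \<alpha> ^ Suc i)"

text \<open>
  Only a zero of \<open>e\<close> leaves a choice, between two digits, so the number of cylinders of level \<open>n\<close>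
  doubles at the zeros of \<open>e\<close> and stays the same elsewhere.
\<close>

lemma card_prefix_sums:
  assumes e: "\<And>i. \<bar>e i\<bar> \<le> 1"
  shows "finite (prefix_sum n ` {\<epsilon>. admissible e \<epsilon>}) \<and>
         card (prefix_sum n ` {\<epsilon>. admissible e \<epsilon>}) \<le> 2 ^ zeros e n"
proof (induction n)
  case 0
  have "(\<lambda>\<epsilon>. 0) ` {\<epsilon>. admissible e \<epsilon>} \<subseteq> {0 :: real}"
    by auto
  from finite_subset[OF this] card_mono[OF _ this] show ?case
    by simp
next
  case (Suc n)
  define F where "F = (\<lambda>n. prefix_sum n ` {\<epsilon>. admissible e \<epsilon>})"
  have fin: "finite (F n)" and card: "card (F n) \<le> 2 ^ zeros e n"
    using Suc by (simp_all add: F_def)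
  have "finite (F (Suc n)) \<and> card (F (Suc n)) \<le> 2 ^ zeros e (Suc n)"
  proof (cases "e n = 0")
    case True
    let ?G = "F n \<union> (\<lambda>x. x + \<alpha> ^ Suc n) ` F n"
    have sub: "F (Suc n) \<subseteq> ?G"
    proof
      fix x assume "x \<in> F (Suc n)"
      then obtain \<epsilon> where \<epsilon>: "admissible e \<epsilon>" "x = prefix_sum n \<epsilon> + of_int (\<epsilon> n) * \<alpha> ^ Suc n"
        by (auto simp: F_def)
      have "\<epsilon> n = 0 \<or> \<epsilon> n = 1"
        using \<epsilon>(1) by (auto simp: admissible_def)
      moreover have "prefix_sum n \<epsilon> \<in> F n"
        using \<epsilon>(1) by (simp add: F_def)
      ultimately show "x \<in> ?G"
        using \<epsilon>(2) by auto
    qed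
    have "card ?G \<le> card (F n) + card ((\<lambda>x. x + \<alpha> ^ Suc n) ` F n)"
      by (rule card_Un_le)
    also have "\<dots> \<le> 2 ^ zeros e n + 2 ^ zeros e n"
      using card card_image_le[OF fin, of "\<lambda>x. x + \<alpha> ^ Suc n"] by linarith
    also have "\<dots> = 2 ^ zeros e (Suc n)"
      using True by (simp add: zeros_Suc)
    finally show ?thesis
      using card_mono[OF _ sub] finite_subset[OF sub] fin by (auto intro: order_trans)
  next
    case False
    let ?G = "(\<lambda>x. x + of_int (if e n = 1 then 1 else 0) * \<alpha> ^ Suc n) ` F n"
    have sub: "F (Suc n) \<subseteq> ?G"
    proof
      fix x assume "x \<in> F (Suc n)"
      then obtain \<epsilon> where \<epsilon>: "admissible e \<epsilon>" "x = prefix_sum n \<epsilon> + of_int (\<epsilon> n) * \<alpha> ^ Suc n"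
        by (auto simp: F_def)
      have "prefix_sum n \<epsilon> \<in> F n"
        using \<epsilon>(1) by (simp add: F_def)
      then show "x \<in> ?G"
        unfolding \<epsilon>(2) admissible_forced[OF \<epsilon>(1) e False] by (rule imageI)
    qed
    have "card ?G \<le> 2 ^ zeros e (Suc n)"
      using card card_image_le[OF fin, of "\<lambda>x. x + of_int (if e n = 1 then 1 else 0) * \<alpha> ^ Suc n"] False
      by (simp add: zeros_Suc)
    then show ?thesis
      using card_mono[OF _ sub] finite_subset[OF sub] fin by (auto intro: order_trans)
  qed
  then show ?case
    by (simp only: F_def)
qed

lemma digit_section_premeasure_le:
  assumes e: "\<And>i. \<bar>e i\<bar> \<le> 1" and s: "0 < s" and \<delta>: "\<alpha> ^ n \<le> \<delta>"
  shows "hausdorff_premeasure s \<delta> (digit_section e) \<le> ennreal (2 ^ zeros e n * (\<alpha> ^ n) powr s)"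
proof -
  define F where "F = prefix_sum n ` {\<epsilon>. admissible e \<epsilon>}"
  define J where "J x = {x..x + \<alpha> ^ n * radius}" for x
  have F: "finite F" "card F \<le> 2 ^ zeros e n"
    using card_prefix_sums[of e n] e by (simp_all add: F_def)
  have "hausdorff_premeasure s \<delta> (digit_section e) \<le> ennreal (card (J ` F) * (\<alpha> ^ n) powr s)"
  proof (rule hausdorff_premeasure_le_finite_cover[OF _ _ _ _ \<delta> s])
    show "digit_section e \<subseteq> \<Union>(J ` F)"
    proof
      fix x assume "x \<in> digit_section e"
      then obtain \<epsilon> where \<epsilon>: "admissible e \<epsilon>" "x = digit_sum \<alpha> \<epsilon>"
        by auto
      have abs: "\<bar>\<epsilon> i\<bar> \<le> 1" for i
        using \<epsilon>(1) by (rule admissible_abs)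
      have "0 \<le> tail \<alpha> \<epsilon> n"
        unfolding tail_def digit_sum_def
      proof (intro suminf_nonneg summable_digits)
        fix i
        have "0 \<le> \<epsilon> (i + n)"
          using \<epsilon>(1) by (auto simp: admissible_def dest: spec[of _ "i + n"])
        then show "0 \<le> of_int (\<epsilon> (i + n)) * \<alpha> ^ Suc i"
          using pos by simp
      qed (rule abs)
      moreover have "tail \<alpha> \<epsilon> n \<le> radius"
        using tail_bounds[of \<epsilon> n] abs by (simp add: abs_le_iff)
      ultimately have "x \<in> J (prefix_sum n \<epsilon>)"
        using digit_sum_split[of \<epsilon> n] abs pos \<epsilon>(2) by (simp add: J_def mult_left_mono)
      then show "x \<in> \<Union>(J ` F)"
        using \<epsilon>(1) by (auto simp: F_def)
    qed
    fix A assume "A \<in> J ` F"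
    then show "bounded A \<and> diameter A \<le> \<alpha> ^ n"
      using pos radius_pos radius_le_1 by (auto simp: J_def mult_left_le)
  qed (use F pos in auto)
  also have "\<dots> \<le> ennreal (2 ^ zeros e n * (\<alpha> ^ n) powr s)"
  proof (intro ennreal_leI mult_right_mono)
    have "card (J ` F) \<le> 2 ^ zeros e n"
      using card_image_le[OF F(1), of J] F(2) by linarith
    then show "real (card (J ` F)) \<le> 2 ^ zeros e n"
      by (metis of_nat_le_iff of_nat_numeral of_nat_power)
  qed simp
  finally show ?thesis .
qed

text \<open>
  For \<open>s\<close> above \<open>d * full_dim\<close>, the $2^{dn + C}$ cylinders of level \<open>n\<close> contribute at most
  $2^C q^n$ to the premeasure, where $q = 2^d \alpha^s < 1$ since
  $\alpha^{d \cdot \mathit{full\_dim}} = 2^{-d}$. Infinitely many good levels suffice.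
\<close>

lemma dim_digit_section_le:
  assumes e: "\<And>i. \<bar>e i\<bar> \<le> 1" and d: "0 \<le> d"
    and often: "\<And>m. \<exists>n\<ge>m. real (zeros e n) \<le> d * n + C"
  shows "hausdorff_dim (digit_section e) \<le> ereal (d * full_dim)"
proof (rule hausdorff_dim_le)
  show "0 \<le> d * full_dim"
    using d full_dim_pos by simp
  fix s assume s: "d * full_dim < s"
  then have s_pos: "0 < s"
    using d full_dim_pos by (meson le_less_trans mult_nonneg_nonneg less_imp_le)
  define q where "q = 2 powr d * \<alpha> powr s"
  have "\<alpha> powr s < \<alpha> powr (full_dim * d)"
    using s pos less_half by (intro powr_less_mono') (auto simp: mult.commute)
  also have "\<dots> = 1 / 2 powr d"
    unfolding powr_powr[symmetric] ratio_powr_full_dim by (simp add: powr_divide)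
  finally have q: "0 \<le> q" "q < 1"
    by (auto simp: q_def field_simps)
  have "hausdorff_premeasure s \<delta> (digit_section e) \<le> 0" if \<delta>: "0 < \<delta>" for \<delta>
  proof (rule ennreal_le_epsilon)
    fix \<eta> :: real assume "0 < \<eta>"
    have "(\<lambda>n. 2 powr C * q ^ n) \<longlonglongrightarrow> 0"
      using q by (intro tendsto_mult_right_zero LIMSEQ_power_zero) simp
    then have "\<forall>\<^sub>F n in sequentially. 2 powr C * q ^ n < \<eta>"
      using \<open>0 < \<eta>\<close> by (rule order_tendstoD)
    moreover have "(\<lambda>n. \<alpha> ^ n) \<longlonglongrightarrow> 0"
      using pos less_half by (intro LIMSEQ_power_zero) simp
    then have "\<forall>\<^sub>F n in sequentially. \<alpha> ^ n < \<delta>"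
      using \<delta> by (rule order_tendstoD)
    ultimately have "\<forall>\<^sub>F n in sequentially. 2 powr C * q ^ n < \<eta> \<and> \<alpha> ^ n < \<delta>"
      by (rule eventually_conj)
    then obtain m where m: "\<And>n. m \<le> n \<Longrightarrow> 2 powr C * q ^ n < \<eta> \<and> \<alpha> ^ n < \<delta>"
      unfolding eventually_sequentially by blast
    obtain n where n: "m \<le> n" "real (zeros e n) \<le> d * n + C"
      using often by blast
    have "2 ^ zeros e n * (\<alpha> ^ n) powr s = 2 powr zeros e n * (\<alpha> powr s) ^ n"
      using pos by (simp add: powr_realpow[symmetric] powr_powr mult.commute)
    also have "\<dots> \<le> 2 powr (d * n + C) * (\<alpha> powr s) ^ n"
      using n(2) by (intro mult_right_mono powr_mono) auto
    also have "\<dots> = 2 powr C * q ^ n"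
      by (simp add: q_def powr_add powr_powr[symmetric] powr_realpow power_mult_distrib)
    also have "\<dots> \<le> \<eta>"
      using m[OF n(1)] by simp
    finally have "hausdorff_premeasure s \<delta> (digit_section e) \<le> ennreal \<eta>"
      using digit_section_premeasure_le[of e s n \<delta>] e s_pos m[OF n(1)]
      by (meson ennreal_leI less_imp_le order_trans)
    then show "hausdorff_premeasure s \<delta> (digit_section e) \<le> 0 + ennreal \<eta>"
      by simp
  qed
  then show "hausdorff_measure s (digit_section e) = 0"
    unfolding hausdorff_measure_def by (auto intro!: antisym SUP_least)
qed

text \<open>
  The free places carry the consecutive binary digits of \<open>u\<close>: at a zero \<open>i\<close> of \<open>e\<close>
  the first \<open>zeros e i\<close> of them have been used already.
\<close>

definition binary_coding :: "(nat \<Rightarrow> int) \<Rightarrow> real \<Rightarrow> nat \<Rightarrow> int" where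
  "binary_coding e u i =
     (if e i = 0 then \<lfloor>2 ^ Suc (zeros e i) * u\<rfloor> mod 2 else if e i = 1 then 1 else 0)"

lemma admissible_binary_coding:
  assumes "\<And>i. \<bar>e i\<bar> \<le> 1"
  shows "admissible e (binary_coding e u)"
  unfolding admissible_def
proof
  fix i
  have "e i = -1 \<or> e i = 0 \<or> e i = 1"
    using assms[of i] by linarith
  moreover have "\<lfloor>2 ^ Suc (zeros e i) * u\<rfloor> mod 2 \<in> {0, 1}"
    by auto
  ultimately show "binary_coding e u i \<in> {0, 1} \<and> binary_coding e u i - e i \<in> {0, 1}"
    unfolding binary_coding_def by auto
qed

lemma floor_double: "\<lfloor>2 * x\<rfloor> = 2 * \<lfloor>x\<rfloor> + \<lfloor>2 * x\<rfloor> mod 2" for x :: real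
  using floor_divide_real_eq_div[of 2 "2 * x"] by simp

lemma binary_coding_agree:
  assumes "u \<in> {0..<1}" "v \<in> {0..<1}" "\<And>i. i < n \<Longrightarrow> binary_coding e u i = binary_coding e v i"
  shows "\<lfloor>2 ^ zeros e n * u\<rfloor> = \<lfloor>2 ^ zeros e n * v\<rfloor>"
  using assms(3)
proof (induction n)
  case 0
  have "\<lfloor>u\<rfloor> = 0" "\<lfloor>v\<rfloor> = 0"
    using assms(1,2) by (auto simp: floor_eq_iff)
  then show ?case by simp
next
  case (Suc n)
  then have IH: "\<lfloor>2 ^ zeros e n * u\<rfloor> = \<lfloor>2 ^ zeros e n * v\<rfloor>"
    by simp
  show ?case
  proof (cases "e n = 0")
    case True
    then have "\<lfloor>2 * (2 ^ zeros e n * u)\<rfloor> mod 2 = \<lfloor>2 * (2 ^ zeros e n * v)\<rfloor> mod 2"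
      using Suc.prems[of n] by (simp add: binary_coding_def mult.assoc)
    then have "\<lfloor>2 * (2 ^ zeros e n * u)\<rfloor> = \<lfloor>2 * (2 ^ zeros e n * v)\<rfloor>"
      using IH floor_double[of "2 ^ zeros e n * u"] floor_double[of "2 ^ zeros e n * v"] by linarith
    then show ?thesis
      using True by (simp add: zeros_Suc mult.assoc)
  next
    case False
    then show ?thesis
      using IH by (simp add: zeros_Suc)
  qed
qed

lemma binary_coding_agree_dist:
  assumes "u \<in> {0..<1}" "v \<in> {0..<1}" "\<And>i. i < n \<Longrightarrow> binary_coding e u i = binary_coding e v i"
  shows "\<bar>u - v\<bar> < 1 / 2 ^ zeros e n"
proof -
  let ?N = "2 ^ zeros e n :: real"
  have "\<lfloor>?N * u\<rfloor> = \<lfloor>?N * v\<rfloor>"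
    using assms by (rule binary_coding_agree)
  then have "\<bar>?N * u - ?N * v\<bar> < 1"
    by linarith
  moreover have "\<bar>?N * u - ?N * v\<bar> = ?N * \<bar>u - v\<bar>"
    by (simp add: right_diff_distrib[symmetric] abs_mult)
  ultimately show ?thesis
    by (simp add: field_simps)
qed

text \<open>
  Let \<open>u\<close> and \<open>v\<close> have codings that differ for the first time at \<open>n\<close>. Then the coded points
  are at least a constant times $\alpha^n$ apart, while \<open>u\<close> and \<open>v\<close> share \<open>zeros e n\<close>
  binary digits and are at most $2^{C - dn} = 2^C \alpha^{n d \cdot \mathit{full\_dim}}$ apart.
\<close>

lemma dim_digit_section_ge:
  assumes e: "\<And>i. \<bar>e i\<bar> \<le> 1" and many: "\<And>n. d * real n \<le> real (zeros e n) + C"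
  shows "ereal (d * full_dim) \<le> hausdorff_dim (digit_section e)"
proof (rule hausdorff_dim_ge)
  fix s assume s: "0 \<le> s" "s < d * full_dim"
  then have "0 < d * full_dim"
    by linarith
  then have d: "0 < d"
    using full_dim_pos by (simp add: zero_less_mult_iff)
  define g where "g u = digit_sum \<alpha> (binary_coding e u)" for u
  define K where "K = 2 powr C * (gap * \<alpha>) powr (- s)"
  have adm: "admissible e (binary_coding e u)" for u
    using e by (rule admissible_binary_coding)
  then have abs: "\<bar>binary_coding e u i\<bar> \<le> 1" for u i
    by (rule admissible_abs)
  show "hausdorff_measure s (digit_section e) \<noteq> 0"
  proof (rule hausdorff_measure_nonzero_if_inverse_hoelder[OF s(1)])
    show "0 < K"
      using gap_pos pos by (simp add: K_def)
    show "g ` {0..<1} \<subseteq> digit_section e"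
      unfolding g_def by (rule image_subsetI, rule imageI, rule CollectI, rule adm)
    fix u v :: real assume uv: "u \<in> {0..<1}" "v \<in> {0..<1}"
    show "\<bar>u - v\<bar> \<le> K * dist (g u) (g v) powr s"
    proof (cases "u = v")
      case False
      \<comment> \<open>Distinct numbers have distinct codings, as \<open>d > 0\<close> makes the number of free places infinite.\<close>
      have ex: "\<exists>n. binary_coding e u n \<noteq> binary_coding e v n"
      proof (rule ccontr)
        assume no: "\<not> ?thesis"
        obtain m :: nat where m: "1 / 2 ^ m < \<bar>u - v\<bar>"
          using False real_arch_pow_inv[of "\<bar>u - v\<bar>" "1/2"] by (auto simp: power_one_over)
        obtain n :: nat where "(m + C) / d < n"
          using reals_Archimedean2 by blast
        then have "m < d * n - C"
          using d by (simp add: field_simps)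
        then have "m \<le> zeros e n"
          using many[of n] by linarith
        then have "1 / 2 ^ zeros e n \<le> (1 / 2 ^ m :: real)"
          by (simp add: frac_le)
        then show False
          using binary_coding_agree_dist[OF uv, of n e] no m by auto
      qed
      define n where "n = (LEAST n. binary_coding e u n \<noteq> binary_coding e v n)"
      have n: "binary_coding e u n \<noteq> binary_coding e v n"
        "\<And>i. i < n \<Longrightarrow> binary_coding e u i = binary_coding e v i"
        using LeastI_ex[OF ex] not_less_Least unfolding n_def by blast+
      have "g u - g v = digit_sum \<alpha> (\<lambda>i. binary_coding e u i - binary_coding e v i)"
        unfolding g_def using abs abs by (rule digit_sum_diff)
      moreover have "\<bar>binary_coding e u i - binary_coding e v i\<bar> \<le> 1" for i
        using adm[of u, unfolded admissible_def, rule_format, of i]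
          adm[of v, unfolded admissible_def, rule_format, of i] by auto
      ultimately have sep: "gap * \<alpha> * \<alpha> ^ n \<le> dist (g u) (g v)"
        using digit_sum_first_difference[of "\<lambda>i. binary_coding e u i - binary_coding e v i" n] n
        by (simp add: dist_real_def mult.assoc)
      have "\<bar>u - v\<bar> \<le> 1 / 2 ^ zeros e n"
        by (rule less_imp_le, rule binary_coding_agree_dist[OF uv]) (rule n(2))
      also have "\<dots> = 2 powr (- real (zeros e n))"
        by (simp add: powr_minus powr_realpow divide_inverse)
      also have "\<dots> \<le> 2 powr (C - d * n)"
        using many[of n] by (intro powr_mono) auto
      also have "\<dots> = 2 powr C * (1/2) powr (d * n)"
        by (simp add: powr_diff powr_divide)
      also have "\<dots> = 2 powr C * \<alpha> powr (d * full_dim * n)"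
        unfolding ratio_powr_full_dim[symmetric] powr_powr by (simp add: mult_ac)
      also have "\<dots> \<le> 2 powr C * \<alpha> powr (s * n)"
        using s pos less_half by (intro mult_left_mono powr_mono' mult_right_mono) auto
      also have "\<dots> = K * (gap * \<alpha> * \<alpha> ^ n) powr s"
      proof -
        have "(gap * \<alpha>) powr (- s) * (gap * \<alpha>) powr s = 1"
          using pos gap_pos by (simp flip: powr_add)
        moreover have "(\<alpha> ^ n) powr s = \<alpha> powr (s * n)"
          using pos by (simp add: powr_powr mult.commute flip: powr_realpow)
        moreover have "(gap * \<alpha> * \<alpha> ^ n) powr s = (gap * \<alpha>) powr s * (\<alpha> ^ n) powr s"
          by (rule powr_mult)
        ultimately show ?thesis
          by (simp add: K_def mult.assoc[symmetric])
      qed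
      also have "\<dots> \<le> K * dist (g u) (g v) powr s"
        using sep s(1) \<open>0 < K\<close> pos gap_pos by (intro mult_left_mono powr_mono2) auto
      finally show ?thesis .
    qed (use \<open>0 < K\<close> in simp)
  qed
qed

section \<open>Alternating expansions\<close>

lemma tail_pos:
  assumes "\<And>i. S i \<in> {0, 1}" "m \<le> k" "S k = 1"
  shows "0 < tail \<alpha> S m"
  unfolding tail_def digit_sum_def
proof (rule suminf_pos2)
  have "\<bar>S i\<bar> \<le> 1" for i
    using assms(1)[of i] by auto
  then show "summable (\<lambda>i. of_int (S (i + m)) * \<alpha> ^ Suc i)"
    by (rule summable_digits)
  show "0 \<le> of_int (S (i + m)) * \<alpha> ^ Suc i" for i
    using assms(1)[of "i + m"] pos by auto
  show "0 < of_int (S (k - m + m)) * \<alpha> ^ Suc (k - m)"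
    using assms(2,3) pos by simp
qed

text \<open>
  In the sequence of differences of a sequence of zeros and ones, the nonzero digits
  alternate in sign. Summation by parts expresses their tails by
  those of \<open>S\<close>, which lie strictly between the extreme values 0 and \<open>radius\<close>.
\<close>

lemma alternating_tail_less:
  assumes S: "\<And>i. S i \<in> {0, 1 :: int}" and often: "\<And>m b. b \<in> {0, 1} \<Longrightarrow> \<exists>k\<ge>m. S k = b"
  shows "\<bar>tail \<alpha> (\<lambda>i. S (Suc i) - S i) n\<bar> < \<alpha>"
proof -
  have abs: "\<bar>S i\<bar> \<le> 1" for i
    using S[of i] by auto
  have "tail \<alpha> S (Suc n) - tail \<alpha> S n = tail \<alpha> (\<lambda>i. S (Suc i) - S i) n"
    using digit_sum_diff[of "\<lambda>i. S (i + Suc n)" "\<lambda>i. S (i + n)"] abs by (simp add: tail_def)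
  moreover have "tail \<alpha> S n = \<alpha> * (of_int (S n) + tail \<alpha> S (Suc n))"
    using abs by (rule tail_step)
  ultimately have eq: "tail \<alpha> (\<lambda>i. S (Suc i) - S i) n = (1 - \<alpha>) * tail \<alpha> S (Suc n) - \<alpha> * of_int (S n)"
    by (simp add: algebra_simps)
  obtain k\<^sub>1 where "Suc n \<le> k\<^sub>1" "S k\<^sub>1 = 1"
    using often[of 1 "Suc n"] by blast
  with S have "0 < tail \<alpha> S (Suc n)"
    by (rule tail_pos)
  then have lower: "0 < (1 - \<alpha>) * tail \<alpha> S (Suc n)"
    using less_half by simp
  obtain k\<^sub>0 where k\<^sub>0: "Suc n \<le> k\<^sub>0" "S k\<^sub>0 = 0"
    using often[of 0 "Suc n"] by blast
  have "0 < tail \<alpha> (\<lambda>i. 1 - S i) (Suc n)"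
  proof (rule tail_pos[OF _ k\<^sub>0(1)])
    show "1 - S i \<in> {0, 1}" for i
      using S[of i] by auto
  qed (simp add: k\<^sub>0(2))
  also have "\<dots> = digit_sum \<alpha> (\<lambda>i. 1) - tail \<alpha> S (Suc n)"
    using digit_sum_diff[of "\<lambda>i. 1" "\<lambda>i. S (i + Suc n)"] abs by (simp add: tail_def)
  also have "digit_sum \<alpha> (\<lambda>i. 1) = radius"
    using sums_geometric_radius by (simp add: digit_sum_def sums_iff)
  finally have "(1 - \<alpha>) * tail \<alpha> S (Suc n) < (1 - \<alpha>) * radius"
    using less_half by simp
  also have "\<dots> = \<alpha>"
    using less_half by (simp add: radius_def)
  finally have "(1 - \<alpha>) * tail \<alpha> S (Suc n) < \<alpha>" .
  then show ?thesis
    using lower S[of n] unfolding eq by auto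
qed

text \<open>
  The nonzero digits are put where the Beatty-like sequence
  $\lfloor (1 - d) n \rfloor$ jumps, so that $\lfloor (1 - d) n \rfloor$ of the first $n$ digits
  are nonzero; its parity \<open>S\<close> makes them alternate in sign.
\<close>

lemma unique_digits_of_density:
  fixes d :: real
  assumes le: "\<alpha> \<le> gap" and d: "0 \<le> d" "d < 1"
  shows "\<exists>e. unique_digits \<alpha> e \<and> (\<forall>n. d * n \<le> zeros e n \<and> zeros e n \<le> d * n + 1)"
proof -
  define f where "f n = \<lfloor>(1 - d) * real n\<rfloor>" for n
  define S where "S n = f n mod 2" for n
  define e where "e i = S (Suc i) - S i" for i
  have S: "S n \<in> {0, 1}" for n
    by (auto simp: S_def)
  have f_Suc: "f (Suc n) = f n \<or> f (Suc n) = f n + 1" for n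
  proof -
    have "(1 - d) * real (Suc n) = (1 - d) * real n + (1 - d)"
      by (simp add: algebra_simps)
    then have "f n \<le> f (Suc n)" "f (Suc n) \<le> f n + 1"
      using d unfolding f_def by linarith+
    then show ?thesis by linarith
  qed
  have e_0: "e n = 0 \<longleftrightarrow> f (Suc n) = f n" for n
    using f_Suc[of n] by (auto simp: e_def S_def) presburger
  have zeros: "int (zeros e n) = int n - f n" for n
  proof (induction n)
    case 0
    show ?case by (simp add: f_def)
  next
    case (Suc n)
    then show ?case
      using f_Suc[of n] e_0[of n] by (auto simp: zeros_Suc)
  qed
  have "\<exists>k\<ge>m. S k = b" if "b \<in> {0, 1}" for m b
  proof -
    \<comment> \<open>The floors take every natural number \<open>j\<close> as a value; this one has the parity \<open>b\<close> and is
      large enough to be attained only beyond \<open>m\<close>.\<close>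
    define j where "j = 2 * m + nat b"
    define k where "k = nat \<lceil>j / (1 - d)\<rceil>"
    have "real k = of_int \<lceil>j / (1 - d)\<rceil>"
      using d by (simp add: k_def)
    then have "j / (1 - d) \<le> k" "k < j / (1 - d) + 1"
      by linarith+
    then have k: "j \<le> (1 - d) * k" "(1 - d) * k < j + (1 - d)"
      using d by (simp_all add: field_simps)
    then have "f k = j"
      using d unfolding f_def by (intro floor_unique) auto
    then have "S k = b"
      using that by (auto simp: S_def j_def)
    moreover have "(1 - d) * k \<le> k"
      using d by (simp add: mult_left_le_one_le)
    then have "m \<le> k"
      using k(1) by (simp add: j_def)
    ultimately show ?thesis by blast
  qed
  then have "\<bar>tail \<alpha> (\<lambda>i. S (Suc i) - S i) n\<bar> < \<alpha>" for n
    by (intro alternating_tail_less S)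
  then have "\<bar>tail \<alpha> e n\<bar> < gap" for n
    unfolding e_def using le by (rule less_le_trans)
  moreover have "\<bar>e i\<bar> \<le> 1" for i
    using S[of i] S[of "Suc i"] by (auto simp: e_def)
  ultimately have "unique_digits \<alpha> e"
    by (intro unique_digits_if_small_tails)
  moreover have "d * n \<le> zeros e n \<and> zeros e n \<le> d * n + 1" for n
  proof -
    have "real (zeros e n) = real n - of_int (f n)"
      using zeros[of n] by linarith
    moreover have "of_int (f n) \<le> (1 - d) * n" "(1 - d) * n < of_int (f n) + 1"
      unfolding f_def by linarith+
    ultimately show ?thesis
      by (simp add: algebra_simps)
  qed
  ultimately show ?thesis by blast
qed

lemma unique_digits_zero: "unique_digits \<alpha> (\<lambda>_. 0)"
  using gap_pos by (intro unique_digits_if_small_tails) (simp_all add: tail_def digit_sum_def)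

lemma D_set_subset: "D_set \<alpha> \<subseteq> {0..ereal full_dim}"
proof -
  have "hausdorff_dim (digit_section e) \<le> ereal (1 * full_dim)" if "unique_digits \<alpha> e" for e
    using unique_digits_abs[OF that] zeros_le
    by (intro dim_digit_section_le[where C = 0]) auto
  then show ?thesis
    unfolding D_set_eq by (auto simp: hausdorff_dim_nonneg)
qed

lemma D_set_eq_interval:
  assumes "\<alpha> \<le> gap"
  shows "D_set \<alpha> = {0..ereal full_dim}"
proof (rule antisym[OF D_set_subset], rule subsetI)
  fix x assume "x \<in> {0..ereal full_dim}"
  then obtain r where r: "x = ereal r" "0 \<le> r" "r \<le> full_dim"
    by (cases x) auto
  define d where "d = r / full_dim"
  have d: "0 \<le> d" "d \<le> 1" "d * full_dim = r"
    using r full_dim_pos by (auto simp: d_def)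
  obtain e where e: "unique_digits \<alpha> e" "\<And>n. d * n \<le> zeros e n" "\<And>n. zeros e n \<le> d * n + 1"
  proof (cases "d = 1")
    case True
    have "zeros (\<lambda>_. 0) n = n" for n
      by (simp add: zeros_def)
    then show ?thesis
      using that[OF unique_digits_zero] True by simp
  next
    case False
    then show ?thesis
      using unique_digits_of_density[OF assms d(1)] d(2) that by fastforce
  qed
  have "hausdorff_dim (digit_section e) = ereal (d * full_dim)"
  proof (rule antisym)
    show "hausdorff_dim (digit_section e) \<le> ereal (d * full_dim)"
      using unique_digits_abs[OF e(1)] d(1) e(3) by (intro dim_digit_section_le[where C = 1]) auto
    show "ereal (d * full_dim) \<le> hausdorff_dim (digit_section e)"
      using unique_digits_abs[OF e(1)] e(2) by (intro dim_digit_section_ge[where C = 0]) auto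
  qed
  then show "x \<in> D_set \<alpha>"
    unfolding D_set_eq r(1) using e(1) d(3) by (metis imageI mem_Collect_eq)
qed

section \<open>A gap below the full dimension\<close>

text \<open>
  The bounds for unique expansions are two-sided only at the zero itself. They stay so
  from there on: a digit 1 preceding a tail \<open>r\<close> requires \<open>\<alpha> * (1 + r) < gap\<close>, so
  \<open>r\<close> is less than \<open>gap / \<alpha> - 1\<close>, which is negative.
\<close>

lemma unique_tails_after_zero:
  assumes third: "1/3 \<le> \<alpha>" and gap: "gap < \<alpha>" and u: "unique_digits \<alpha> e" and p: "e p = 0" "p < m"
  shows "\<bar>tail \<alpha> e m\<bar> < gap \<and> (e m \<noteq> 0 \<longrightarrow> 1 - gap / \<alpha> < \<bar>tail \<alpha> e (Suc m)\<bar>)"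
proof -
  note less = unique_tail_less_gap[OF third u] and greater = unique_tail_greater_gap[OF third u]
  note abs = unique_digits_abs[OF u]
  have next_tail: "tail \<alpha> e (Suc n) < gap / \<alpha> - 1" if "e n = 1" "\<bar>tail \<alpha> e n\<bar> < gap" for n
  proof -
    have "\<alpha> * (1 + tail \<alpha> e (Suc n)) < gap"
      using that tail_step[of e n] abs by simp
    then show ?thesis
      using pos by (simp add: field_simps)
  qed
  have next_tail': "1 - gap / \<alpha> < tail \<alpha> e (Suc n)" if "e n = -1" "\<bar>tail \<alpha> e n\<bar> < gap" for n
  proof -
    have "- gap < \<alpha> * (tail \<alpha> e (Suc n) - 1)"
      using that tail_step[of e n] abs by simp
    then show ?thesis
      using pos by (simp add: field_simps)
  qed
  have neg: "gap / \<alpha> < 1"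
    using gap pos by simp
  have digit: "e n = 1 \<or> e n = 0 \<or> e n = -1" for n
    using abs[of n] by linarith
  have small: "\<bar>tail \<alpha> e m\<bar> < gap"
    using Suc_leI[OF \<open>p < m\<close>]
  proof (induction m rule: dec_induct)
    case base
    then show ?case
      using less[of p] greater[of p] p(1) by (simp add: abs_less_iff)
  next
    case (step n)
    then show ?case
      using digit[of n] less[of n] greater[of n] next_tail[of n] next_tail'[of n] neg gap_pos
      by (auto simp: abs_less_iff)
  qed
  moreover have "1 - gap / \<alpha> < \<bar>tail \<alpha> e (Suc m)\<bar>" if "e m \<noteq> 0"
    using small digit[of m] that next_tail[of m] next_tail'[of m] by linarith
  ultimately show ?thesis by blast
qed

lemma tail_of_zeros:
  assumes "\<And>i. \<bar>e i\<bar> \<le> 1" "\<And>j. n \<le> j \<Longrightarrow> j < n + k \<Longrightarrow> e j = 0"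
  shows "tail \<alpha> e n = \<alpha> ^ k * tail \<alpha> e (n + k)"
  using assms(2)
proof (induction k)
  case (Suc k)
  then show ?case
    using tail_step[of e "n + k"] assms(1) by simp
qed simp

text \<open>
  After a run of \<open>k\<close> zeros following \<open>m\<close>, the tail at \<open>Suc m\<close> is at most \<open>\<alpha> ^ k\<close> in absolute
  value, which is too small to follow a nonzero digit at \<open>m\<close>.
\<close>

lemma nonzero_recurs:
  assumes third: "1/3 \<le> \<alpha>" and gap: "gap < \<alpha>" and k: "\<alpha> ^ k < 1 - gap / \<alpha>"
    and u: "unique_digits \<alpha> e" and p: "e p = 0" "p < q" and q: "e q \<noteq> 0" "q \<le> m"
  shows "\<exists>j. m \<le> j \<and> j \<le> m + k \<and> e j \<noteq> 0"
  using q(2)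
proof (induction m rule: dec_induct)
  case base
  then show ?case using q(1) by auto
next
  case (step m)
  then obtain j where j: "m \<le> j" "j \<le> m + k" "e j \<noteq> 0" by blast
  show ?case
  proof (cases "j = m")
    case True
    have "\<exists>i. Suc m \<le> i \<and> i < Suc m + k \<and> e i \<noteq> 0"
    proof (rule ccontr)
      assume "\<not> ?thesis"
      then have "tail \<alpha> e (Suc m) = \<alpha> ^ k * tail \<alpha> e (Suc m + k)"
        using unique_digits_abs[OF u] by (intro tail_of_zeros) auto
      moreover have "\<bar>tail \<alpha> e (Suc m + k)\<bar> \<le> 1"
        using tail_bounds[of e "Suc m + k"] unique_digits_abs[OF u] radius_le_1 by simp
      ultimately have "\<bar>tail \<alpha> e (Suc m)\<bar> \<le> \<alpha> ^ k"
        using pos by (simp add: abs_mult mult_left_le)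
      moreover have "1 - gap / \<alpha> < \<bar>tail \<alpha> e (Suc m)\<bar>"
        using unique_tails_after_zero[OF third gap u p(1), of m] p(2) step.hyps True j(3) by simp
      ultimately show False
        using k by linarith
    qed
    then show ?thesis by auto
  next
    case False
    then show ?thesis
      using j by (intro exI[of _ j]) auto
  qed
qed

lemma zeros_add_le: "zeros e (n + k) \<le> zeros e n + k"
  by (induction k) (auto simp: zeros_Suc)

lemma zeros_add_less:
  assumes "n \<le> j" "j < n + k" "e j \<noteq> 0"
  shows "zeros e (n + k) < zeros e n + k"
proof -
  have "zeros e (n + k) \<le> zeros e (Suc j) + (n + k - Suc j)"
    using zeros_add_le[of e "Suc j" "n + k - Suc j"] assms by simp
  also have "zeros e (Suc j) = zeros e j"
    using assms by (simp add: zeros_Suc)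
  also have "zeros e j \<le> zeros e n + (j - n)"
    using zeros_add_le[of e n "j - n"] assms by simp
  finally have "zeros e (n + k) \<le> zeros e n + (j - n) + (n + k - Suc j)"
    by simp
  then show ?thesis
    using assms by linarith
qed

text \<open>
  Three kinds of unique expansions: those without zeros give a single point; those with a zero and
  a later nonzero digit have, from that digit on, at most \<open>k\<close> zeros in each block of \<open>k + 1\<close>
  places; those which end in zeros have the full dimension.
\<close>

lemma D_set_gap:
  assumes third: "1/3 \<le> \<alpha>" and gap: "gap < \<alpha>" and k: "\<alpha> ^ k < 1 - gap / \<alpha>"
  shows "D_set \<alpha> \<inter> {ereal (real k / (real k + 1) * full_dim)<..<ereal full_dim} = {}"
proof -
  have "hausdorff_dim (digit_section e) \<le> ereal (real k / (real k + 1) * full_dim) \<or>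
        ereal full_dim \<le> hausdorff_dim (digit_section e)" if u: "unique_digits \<alpha> e" for e
  proof -
    note abs = unique_digits_abs[OF u]
    consider "\<And>i. e i \<noteq> 0" | p q where "e p = 0" "p < q" "e q \<noteq> 0"
      | p where "\<And>i. p \<le> i \<Longrightarrow> e i = 0"
      by (metis le_less)
    then show ?thesis
    proof cases
      case 1
      then have "zeros e n = 0" for n
        by (simp add: zeros_def)
      then have "hausdorff_dim (digit_section e) \<le> ereal (real k / (real k + 1) * full_dim)"
        using abs by (intro dim_digit_section_le[where C = 0]) auto
      then show ?thesis ..
    next
      case (2 p q)
      have block: "zeros e (q + r * (k + 1)) \<le> q + r * k" for r
      proof (induction r)
        case 0
        show ?case using zeros_le[of e q] by simp
      next
        case (Suc r)
        let ?m = "q + r * (k + 1)"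
        obtain j where "?m \<le> j" "j \<le> ?m + k" "e j \<noteq> 0"
          using nonzero_recurs[OF third gap k u 2, of ?m] by auto
        then have "zeros e (?m + (k + 1)) < zeros e ?m + (k + 1)"
          by (intro zeros_add_less[of _ j]) auto
        then show ?case
          using Suc by (simp add: add_ac)
      qed
      have "hausdorff_dim (digit_section e) \<le> ereal (real k / (real k + 1) * full_dim)"
      proof (rule dim_digit_section_le[where C = q])
        fix m
        let ?n = "q + m * (k + 1)"
        have "real (zeros e ?n) \<le> q + m * k"
          using block[of m] by (metis of_nat_le_iff)
        also have "\<dots> \<le> real k / (real k + 1) * ?n + q"
          by (simp add: field_simps)
        finally have "real (zeros e ?n) \<le> real k / (real k + 1) * ?n + q" .
        moreover have "m \<le> ?n" by simp
        ultimately show "\<exists>n\<ge>m. real (zeros e n) \<le> real k / (real k + 1) * n + q" by blast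
      qed (use abs in auto)
      then show ?thesis ..
    next
      case (3 p)
      have "n \<le> zeros e n + p" for n
      proof (induction n)
        case (Suc n)
        then show ?case
          using 3[of n] by (cases "p \<le> n") (auto simp: zeros_Suc)
      qed simp
      then have "1 * real n \<le> real (zeros e n) + real p" for n
        by (metis mult_1 of_nat_add of_nat_le_iff)
      then have "ereal (1 * full_dim) \<le> hausdorff_dim (digit_section e)"
        using abs by (intro dim_digit_section_ge)
      then show ?thesis by simp
    qed
  qed
  then have "x \<le> ereal (real k / (real k + 1) * full_dim) \<or> ereal full_dim \<le> x" if "x \<in> D_set \<alpha>" for x
    using that unfolding D_set_eq by (elim imageE CollectE) simp
  then show ?thesis
    by (fastforce simp: not_le[symmetric])
qed

lemma D_set_psubset:
  assumes third: "1/3 \<le> \<alpha>" and gap: "gap < \<alpha>"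
  shows "D_set \<alpha> \<subset> {0..ereal full_dim}"
proof (rule psubsetI[OF D_set_subset])
  have "0 < 1 - gap / \<alpha>"
    using gap pos by simp
  then obtain k where k: "\<alpha> ^ k < 1 - gap / \<alpha>"
    using real_arch_pow_inv[of _ \<alpha>] less_half by fastforce
  \<comment> \<open>Any value between \<open>k / (k + 1) * full_dim\<close> and \<open>full_dim\<close> is missing; this is the midpoint.\<close>
  define v where "v = (real k + 1/2) / (real k + 1) * full_dim"
  have "real k / (real k + 1) < (real k + 1/2) / (real k + 1)" "(real k + 1/2) / (real k + 1) < 1"
    "0 \<le> (real k + 1/2) / (real k + 1)"
    by (simp_all add: field_simps)
  then have v: "real k / (real k + 1) * full_dim < v" "v < full_dim" "0 \<le> v"
    using full_dim_pos unfolding v_def by (simp_all only: mult_less_cancel_right_pos mult_less_cancel_right2 mult_nonneg_nonneg less_imp_le) simp_all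
  then have "ereal v \<notin> D_set \<alpha>"
    using D_set_gap[OF third gap k] by auto
  then show "D_set \<alpha> \<noteq> {0..ereal full_dim}"
    using v by auto
qed

lemma ratio_le_gap_iff: "\<alpha> \<le> gap \<longleftrightarrow> \<alpha> \<le> (3 - sqrt 5) / 2"
proof -
  have "\<alpha> \<le> gap \<longleftrightarrow> \<alpha> * (1 - \<alpha>) \<le> 1 - 2 * \<alpha>"
    using less_half by (simp add: gap_def field_simps)
  also have "\<dots> \<longleftrightarrow> 5 \<le> (3 - 2 * \<alpha>)\<^sup>2"
    by (simp add: power2_eq_square algebra_simps) linarith
  also have "\<dots> \<longleftrightarrow> sqrt 5 \<le> 3 - 2 * \<alpha>"
    using less_half real_sqrt_le_iff[of 5 "(3 - 2 * \<alpha>)\<^sup>2"] by simp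
  also have "\<dots> \<longleftrightarrow> \<alpha> \<le> (3 - sqrt 5) / 2"
    by (simp add: field_simps)
  finally show ?thesis .
qed

end

theorem theorem1p2:
  shows "(\<forall>\<alpha>\<in>{1/3<..(3 - sqrt 5)/2}. D_set \<alpha> = {0..ereal (ln 2 / (- ln \<alpha>))})
       \<and> (\<forall>\<alpha>\<in>{(3 - sqrt 5)/2<..<1/2}. D_set \<alpha> \<subset> {0..ereal (ln 2 / (- ln \<alpha>))})"
proof (intro conjI ballI)
  have "2 < sqrt (5 :: real)"
    by (rule real_less_rsqrt) simp
  fix \<alpha> :: real assume \<alpha>: "\<alpha> \<in> {1/3<..(3 - sqrt 5)/2}"
  interpret contraction \<alpha>
    using \<alpha> \<open>2 < sqrt 5\<close> by unfold_locales auto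
  show "D_set \<alpha> = {0..ereal (ln 2 / (- ln \<alpha>))}"
    using D_set_eq_interval ratio_le_gap_iff \<alpha> by (simp add: full_dim_def)
next
  have "sqrt (5 :: real) < 7/3"
    by (rule real_less_lsqrt) (auto simp: power2_eq_square)
  fix \<alpha> :: real assume \<alpha>: "\<alpha> \<in> {(3 - sqrt 5)/2<..<1/2}"
  interpret contraction \<alpha>
    using \<alpha> \<open>sqrt 5 < 7/3\<close> by unfold_locales auto
  show "D_set \<alpha> \<subset> {0..ereal (ln 2 / (- ln \<alpha>))}"
    using D_set_psubset ratio_le_gap_iff \<alpha> \<open>sqrt 5 < 7/3\<close> by (simp add: full_dim_def)
qed

end
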